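(* Let $d\ge1$, let $\varphi:B_d\to\mathbb{D}$ be a holomorphic function and let $\sigma_\alpha=\sigma_\alpha[\varphi]$, $\alpha\in\mathbb{T}$, be its Clark measures. Then \[ \int_{\mathbb{T}}\int_{S_d} f\,d\sigma_\alpha\,d\Sigma_1(\alpha)=\int_{S_d} f\,d\Sigma_d \] for all $f\in C(S_d)$.
   Context: $B_d$ is the open unit ball of $\mathbb{C}^d$, $S_d=\partial B_d$, $\mathbb{D}=B_1$, $\mathbb{T}=\partial\mathbb{D}$; $\Sigma_d$ is the normalized Lebesgue measure on $S_d$ (so $\Sigma_1$ is the normalized Lebesgue measure on $\mathbb{T}$). For $\alpha\in\mathbb{T}$, the Clark measure $\sigma_\alpha[\varphi]$ is the unique positive Borel measure on $S_d$ such that $\int_{S_d}\left(\frac{1-|z|^2}{|1-\langle z,\zeta\rangle|^2}\right)^d d\sigma_\alpha[\varphi](\zeta)=\mathrm{Re}\,\frac{\alpha+\varphi(z)}{\alpha-\varphi(z)}$ for all $z\in B_d$. *)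

theory Defs
  imports "HOL-Analysis.Analysis"
begin

text \<open>
  The space of \<open>d\<close>-tuples of complex numbers is \<^typ>\<open>complex^'d\<close> with \<open>d = CARD('d) \<ge> 1\<close>, the unit
  ball is \<^term>\<open>ball 0 1\<close> and the unit sphere is \<^term>\<open>sphere 0 1\<close> (for the Euclidean norm). The disc and
  the circle are taken in \<^typ>\<open>complex\<close> itself.
\<close>

text \<open>The Hermitian inner product; the library's \<^const>\<open>inner\<close> is only its real part.\<close>

definition hermitian :: "complex^'d \<Rightarrow> complex^'d \<Rightarrow> complex"
  where "hermitian z w = (\<Sum>i\<in>UNIV. z $ i * cnj (w $ i))"

text \<open>Holomorphy in several variables: real (Frechet) differentiable with complex-linear derivative.\<close>

definition holomorphic_several :: "(complex^'d \<Rightarrow> complex) \<Rightarrow> (complex^'d) set \<Rightarrow> bool"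
  where "holomorphic_several f S \<longleftrightarrow>
    open S \<and> (\<forall>z\<in>S. \<exists>D. (f has_derivative D) (at z) \<and> (\<forall>c v. D (c *s v) = c * D v))"

text \<open>
  Normalized Lebesgue (surface) measure on the unit sphere of a Euclidean space, via polar coordinates:
  the measure of a Borel set \<open>A\<close> is the volume of the part of the unit ball lying over \<open>A\<close> under
  radial projection \<open>x \<mapsto> x / \<parallel>x\<parallel>\<close> (this is \<^const>\<open>sgn\<close>), divided by the volume of the ball.
\<close>

definition sphere_measure :: "'a::euclidean_space measure"
  where "sphere_measure =
    restrict_space (distr (uniform_measure lborel (ball 0 1)) borel sgn) (sphere 0 1)"

definition poisson_kernel :: "complex^'d \<Rightarrow> complex^'d \<Rightarrow> real"
  where "poisson_kernel z w =
    ((1 - (norm z)\<^sup>2) / (cmod (1 - hermitian z w))\<^sup>2) ^ CARD('d)"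

text \<open>
  \<open>clark_measure \<phi> \<alpha> \<mu>\<close>: \<open>\<mu>\<close> is the Clark measure of \<open>\<phi>\<close> at \<open>\<alpha>\<close>. There is exactly one such \<open>\<mu>\<close> when
  \<open>\<phi>\<close> is a holomorphic map from the ball to the disc and \<open>\<alpha>\<close> lies on the circle. Finiteness of \<open>\<mu>\<close> is
  the case \<open>z = 0\<close>, where the kernel is constantly 1.
\<close>

definition clark_measure ::
    "(complex^'d \<Rightarrow> complex) \<Rightarrow> complex \<Rightarrow> (complex^'d) measure \<Rightarrow> bool"
  where "clark_measure \<phi> \<alpha> \<mu> \<longleftrightarrow>
    sets \<mu> = sets (restrict_space borel (sphere 0 1)) \<and>
    (\<forall>z\<in>ball 0 1. has_bochner_integral \<mu> (poisson_kernel z) (Re ((\<alpha> + \<phi> z) / (\<alpha> - \<phi> z))))"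

end

theory Submission
  imports
    Defs
    "HOL-Complex_Analysis.Cauchy_Integral_Formula"
    "HOL-Probability.Probability_Measure"
begin

text \<open>
  Write \<open>P\<close> for the Poisson kernel and \<open>H\<^sub>\<alpha> = Re ((\<alpha> + \<phi>) / (\<alpha> - \<phi>))\<close>. The Poisson integral
  \<open>f\<^sub>r(\<zeta>) = \<integral> P(r\<eta>, \<zeta>) f(\<eta>) d\<Sigma>(\<eta>)\<close> tends to \<open>f\<close> as \<open>r \<rightarrow> 1\<close>, and by Fubini and the defining
  property of the Clark measure \<open>\<integral> f\<^sub>r d\<sigma>\<^sub>\<alpha> = \<integral> H\<^sub>\<alpha>(r\<eta>) f(\<eta>) d\<Sigma>(\<eta>)\<close>. The right-hand side is measurable in \<open>\<alpha>\<close>,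
  bounded uniformly in \<open>\<alpha>\<close> and \<open>r\<close>, and its mean over \<open>\<alpha>\<close> is \<open>\<integral> f d\<Sigma>\<close>, since \<open>\<alpha> \<mapsto> H\<^sub>\<alpha>(z)\<close> is a
  Poisson kernel of the disc. Dominated convergence as \<open>r \<rightarrow> 1\<close> concludes.
\<close>

section \<open>Invariance of the surface measure\<close>

lemma nn_integral_lborel_translation:
  fixes g :: "'a::euclidean_space \<Rightarrow> ennreal"
  assumes [measurable]: "g \<in> borel_measurable borel"
  shows "(\<integral>\<^sup>+x. g (c + x) \<partial>lborel) = (\<integral>\<^sup>+x. g x \<partial>lborel)"
proof -
  have "(\<integral>\<^sup>+x. g x \<partial>lborel) = (\<integral>\<^sup>+x. g x \<partial>distr lborel borel ((+) c))"
    by (simp add: lborel_distr_plus)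
  also have "\<dots> = (\<integral>\<^sup>+x. g (c + x) \<partial>lborel)"
    by (rule nn_integral_distr) auto
  finally show ?thesis ..
qed

lemma emeasure_lborel_ball_nonzero: "0 < r \<Longrightarrow> emeasure lborel (ball (c::'a::euclidean_space) r) \<noteq> 0"
  by (metis emeasure_lborel_ball_finite measure_def  enn2real_0 content_ball_pos less_irrefl)

lemma borel_measurable_orthogonal_transformation:
  fixes U :: "'a::euclidean_space \<Rightarrow> 'a"
  assumes "orthogonal_transformation U"
  shows "U \<in> borel_measurable borel"
  by (intro borel_measurable_continuous_onI linear_continuous_on linear_conv_bounded_linear[THEN iffD1] orthogonal_transformation_linear assms)

text \<open>Uniqueness of Haar measure: integrate \<open>1\<^sub>A (U x + y) 1\<^sub>B y\<close>, \<open>B\<close> the unit ball, in both orders.\<close>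

lemma distr_lborel_orthogonal_transformation:
  fixes U :: "'a::euclidean_space \<Rightarrow> 'a"
  assumes U: "orthogonal_transformation U"
  shows "distr lborel borel U = lborel"
proof (rule measure_eqI)
  show "sets (distr lborel borel U) = sets lborel" by simp
next
  fix A assume "A \<in> sets (distr lborel borel U)"
  then have A[measurable]: "A \<in> sets borel" by simp
  have [measurable]: "U \<in> borel_measurable borel"
    by (rule borel_measurable_orthogonal_transformation[OF U])
  define B where "B = ball (0::'a) 1"
  have [measurable]: "B \<in> sets borel" by (simp add: B_def)
  \<comment> \<open>Through a right inverse, a shift by \<open>y\<close> outside \<open>U\<close>
    becomes a translation by \<open>V y\<close> of its argument, so that translation invariance
    applies.\<close>
  obtain V where V: "\<And>y. U (V y) = y"
    using orthogonal_transformation_surj[OF U] by (metis surjD)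
  have add: "U (x + y) = U x + U y" for x y
    using U by (simp add: orthogonal_transformation_def linear_add)
  \<comment> \<open>The ball is symmetric and \<open>U\<close> preserves norms; at the end of the
    computation this removes \<open>U\<close> from the second factor.\<close>
  have B: "indicator B (- U x) = (indicator B x :: ennreal)" for x
    by (simp add: B_def indicator_def orthogonal_transformation_norm[OF U])
  let ?a = "indicator A :: 'a \<Rightarrow> ennreal" and ?b = "indicator B :: 'a \<Rightarrow> ennreal"
  have "emeasure (distr lborel borel U) A * emeasure lborel B
      = (\<integral>\<^sup>+y. (\<integral>\<^sup>+x. ?a (U x) * ?b y \<partial>lborel) \<partial>lborel)"
  proof -
    have "emeasure (distr lborel borel U) A = (\<integral>\<^sup>+x. ?a (U x) \<partial>lborel)"
      by (subst nn_integral_distr[symmetric, where M'=borel]) auto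
    then show ?thesis
      by (simp add: nn_integral_multc nn_integral_cmult)
  qed
  also have "\<dots> = (\<integral>\<^sup>+y. (\<integral>\<^sup>+x. ?a (U (V y + x)) * ?b y \<partial>lborel) \<partial>lborel)"
    by (subst nn_integral_lborel_translation) auto
  also have "\<dots> = (\<integral>\<^sup>+y. (\<integral>\<^sup>+x. ?a (U x + y) * ?b y \<partial>lborel) \<partial>lborel)"
    by (simp add: add V add.commute)
  also have "\<dots> = (\<integral>\<^sup>+x. (\<integral>\<^sup>+y. ?a (U x + y) * ?b y \<partial>lborel) \<partial>lborel)"
    by (rule lborel_pair.Fubini') measurable
  also have "\<dots> = (\<integral>\<^sup>+x. (\<integral>\<^sup>+y. ?a (U x + (- U x + y)) * ?b (- U x + y) \<partial>lborel) \<partial>lborel)"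
    by (subst nn_integral_lborel_translation) auto
  also have "\<dots> = (\<integral>\<^sup>+x. (\<integral>\<^sup>+y. ?a y * ?b (- U x + y) \<partial>lborel) \<partial>lborel)"
    by simp
  also have "\<dots> = (\<integral>\<^sup>+y. (\<integral>\<^sup>+x. ?a y * ?b (- U x + y) \<partial>lborel) \<partial>lborel)"
    by (rule lborel_pair.Fubini') measurable
  also have "\<dots> = (\<integral>\<^sup>+y. (\<integral>\<^sup>+x. ?a y * ?b (- U (V y + x) + y) \<partial>lborel) \<partial>lborel)"
    by (subst nn_integral_lborel_translation[where c = "V _"]) auto
  also have "\<dots> = (\<integral>\<^sup>+y. (\<integral>\<^sup>+x. ?a y * ?b x \<partial>lborel) \<partial>lborel)"
    by (simp add: add V B)
  also have "\<dots> = emeasure lborel A * emeasure lborel B"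
    by (simp add: nn_integral_multc nn_integral_cmult)
  finally show "emeasure (distr lborel borel U) A = emeasure lborel A"
    using emeasure_lborel_ball_nonzero[of 1 "0::'a"] emeasure_lborel_ball_finite[of "0::'a" 1]
    by (metis B_def ennreal_mult_divide_eq less_top infinity_ennreal_def zero_less_one)
qed

section \<open>The surface measure as a push-forward of volume\<close>

lemma sets_sphere_measure: "sets sphere_measure = sets (restrict_space borel (sphere 0 1))"
  by (simp add: sphere_measure_def sets_restrict_space)

lemma space_sphere_measure [simp]: "space sphere_measure = sphere 0 1"
  by (simp add: sphere_measure_def space_restrict_space)

lemma emeasure_sphere_measure:
  fixes A :: "'a::euclidean_space set"
  assumes "A \<in> sets sphere_measure"
  shows "emeasure sphere_measure A =
    emeasure lborel (ball 0 1 \<inter> sgn -` A) / emeasure lborel (ball (0::'a) 1)"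
proof -
  have A: "A \<in> sets borel" "A \<subseteq> sphere 0 1"
    using assms by (auto simp: sets_sphere_measure sets_restrict_space_iff)
  have [measurable]: "(sgn :: 'a \<Rightarrow> 'a) \<in> borel_measurable borel" by (simp add: sgn_div_norm[abs_def])
  have [measurable]: "(sgn :: 'a \<Rightarrow> 'a) -` A \<in> sets borel"
    using measurable_sets[of sgn borel borel A] A by (simp)
  have "emeasure sphere_measure A = emeasure (uniform_measure lborel (ball 0 1)) (sgn -` A)"
    using A by (simp add: sphere_measure_def emeasure_restrict_space emeasure_distr)
  then show ?thesis by (simp add: divide_ennreal_def)
qed

text \<open>Every point of the ball except the origin, where \<open>sgn 0 = 0\<close>, projects into
  the sphere, and a single point is a null set.\<close>

lemma prob_space_sphere_measure: "prob_space (sphere_measure :: 'a::euclidean_space measure)"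
proof
  have "emeasure lborel (ball 0 1 \<inter> sgn -` sphere (0::'a) 1) = emeasure lborel (ball (0::'a) 1)"
  proof (rule emeasure_eq_AE)
    show "AE x in lborel. (x \<in> ball 0 1 \<inter> sgn -` sphere (0::'a) 1) = (x \<in> ball 0 1)"
      using AE_lborel_singleton[of "0::'a"] by eventually_elim (auto simp: norm_sgn)
    have [measurable]: "(sgn :: 'a \<Rightarrow> 'a) \<in> borel_measurable borel" by (simp add: sgn_div_norm[abs_def])
    show "ball 0 1 \<inter> sgn -` sphere (0::'a) 1 \<in> sets lborel"
      using measurable_sets[of sgn borel borel "sphere (0::'a) 1"] by simp
  qed simp
  moreover have "sphere 0 1 \<in> sets (sphere_measure :: 'a measure)"
    by (metis sets.top space_sphere_measure)
  ultimately show "emeasure sphere_measure (space (sphere_measure :: 'a measure)) = 1"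
    using emeasure_lborel_ball_nonzero[of 1 "0::'a"] emeasure_lborel_ball_finite[of "0::'a" 1]
    by (simp add: emeasure_sphere_measure less_top ennreal_divide_self)
qed

lemma measurable_sphere_orthogonal_transformation:
  fixes U :: "'a::euclidean_space \<Rightarrow> 'a"
  assumes U: "orthogonal_transformation U"
  shows "U \<in> sphere_measure \<rightarrow>\<^sub>M sphere_measure"
proof -
  have "U \<in> restrict_space borel (sphere 0 1) \<rightarrow>\<^sub>M restrict_space borel (sphere 0 1)"
    by (rule measurable_restrict_space3[OF borel_measurable_orthogonal_transformation[OF U]])
      (auto simp: orthogonal_transformation_norm[OF U])
  then show ?thesis
    by (simp cong: measurable_cong_sets add: sets_sphere_measure)
qed

text \<open>\<open>U\<close> commutes with radial projection and preserves the ball, so the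
  invariance of Lebesgue measure descends to the sphere.\<close>

lemma distr_sphere_measure_orthogonal_transformation:
  fixes U :: "'a::euclidean_space \<Rightarrow> 'a"
  assumes U: "orthogonal_transformation U"
  shows "distr sphere_measure sphere_measure U = sphere_measure"
proof (rule measure_eqI)
  fix A assume "A \<in> sets (distr sphere_measure sphere_measure U)"
  then have A: "A \<in> sets sphere_measure" by simp
  note m = measurable_sphere_orthogonal_transformation[OF U]
  have [measurable]: "(sgn :: 'a \<Rightarrow> 'a) \<in> borel_measurable borel" by (simp add: sgn_div_norm[abs_def])
  have [measurable]: "U \<in> borel_measurable borel"
    by (rule borel_measurable_orthogonal_transformation[OF U])
  have sgnU: "sgn (U x) = U (sgn x)" for x
    by (simp add: sgn_div_norm orthogonal_transformation_norm[OF U] orthogonal_transformation_scaleR[OF U])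
  have "A \<in> sets borel" using A by (auto simp: sets_sphere_measure sets_restrict_space_iff)
  then have [measurable]: "(sgn :: 'a \<Rightarrow> 'a) -` A \<in> sets borel"
    using measurable_sets[of sgn borel borel A] by (simp)
  \<comment> \<open>Since \<open>A\<close> lies in the sphere, this excludes \<open>x = 0\<close>;
    it allows the intersection with the sphere to be dropped from the preimage below.\<close>
  have sph: "sgn x \<in> sphere 0 1" if "U (sgn x) \<in> A" for x
    using that A by (auto simp: sets_sphere_measure sets_restrict_space orthogonal_transformation_norm[OF U])
  have "emeasure (distr sphere_measure sphere_measure U) A = emeasure sphere_measure (U -` A \<inter> sphere 0 1)"
    using emeasure_distr[OF m A] by simp
  also have "\<dots> = emeasure lborel (ball 0 1 \<inter> sgn -` (U -` A \<inter> sphere 0 1)) / emeasure lborel (ball (0::'a) 1)"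
    using measurable_sets[OF m A] by (intro emeasure_sphere_measure) simp
  also have "ball 0 1 \<inter> sgn -` (U -` A \<inter> sphere 0 1) = U -` (ball 0 1 \<inter> sgn -` A) \<inter> space lborel"
    using sph by (auto simp: sgnU orthogonal_transformation_norm[OF U])
  also have "emeasure lborel \<dots> = emeasure (distr lborel borel U) (ball 0 1 \<inter> sgn -` A)"
    by (rule emeasure_distr[symmetric]) auto
  also have "\<dots> = emeasure lborel (ball 0 1 \<inter> sgn -` A)"
    by (simp add: distr_lborel_orthogonal_transformation[OF U])
  finally show "emeasure (distr sphere_measure sphere_measure U) A = emeasure sphere_measure A"
    by (simp add: emeasure_sphere_measure[OF A])
qed simp

section \<open>Mean values over the sphere\<close>

text \<open>Cauchy's formula at the centre: the derivative of the parametrized circle is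
  \<open>2 * pi * i\<close> times the point itself and cancels the pole of
  \<open>h u / u\<close>.\<close>

lemma has_integral_circle_mean:
  fixes h :: "complex \<Rightarrow> complex"
  assumes "h holomorphic_on ball 0 R" "1 < R"
  shows "((\<lambda>t. h (exp (2 * of_real pi * \<i> * of_real t))) has_integral h 0) {0..1}"
proof -
  have "((\<lambda>u. h u / (u - 0)) has_contour_integral (2 * of_real pi * \<i> * h 0)) (circlepath 0 1)"
    using assms
    by (intro Cauchy_integral_circlepath_simple holomorphic_on_subset[OF assms(1)]) auto
  then have "((\<lambda>t. h (circlepath 0 1 t) / circlepath 0 1 t * vector_derivative (circlepath 0 1) (at t))
      has_integral (2 * of_real pi * \<i> * h 0)) {0..1}"
    by (simp add: has_contour_integral)
  then have "((\<lambda>t. (2 * of_real pi * \<i>) * h (exp (2 * of_real pi * \<i> * of_real t)))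
      has_integral (2 * of_real pi * \<i> * h 0)) {0..1}"
    unfolding vector_derivative_circlepath by (simp add: circlepath mult_ac)
  from has_integral_mult_right[OF this, of "1 / (2 * of_real pi * \<i>)"] show ?thesis
    by simp
qed

text \<open>By invariance \<open>g\<close> and each \<open>g (T t x)\<close> have the same integral.
  Averaging over \<open>t\<close> and exchanging the integrals replaces \<open>g\<close> by its
  orbit mean, which is \<open>c\<close> at every point.\<close>

lemma (in prob_space) integral_eq_orbit_mean:
  fixes g :: "'a \<Rightarrow> complex" and T :: "real \<Rightarrow> 'a \<Rightarrow> 'a"
  assumes T: "(\<lambda>(t, x). T t x) \<in> borel \<Otimes>\<^sub>M M \<rightarrow>\<^sub>M M"
    and inv: "\<And>t. distr M M (T t) = M"
    and g[measurable]: "g \<in> borel_measurable M"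
    and bound: "\<And>x. x \<in> space M \<Longrightarrow> norm (g x) \<le> C"
    and mean: "\<And>x. x \<in> space M \<Longrightarrow> ((\<lambda>t. g (T t x)) has_integral c) {0..1}"
  shows "integral\<^sup>L M g = c"
proof -
  \<comment> \<open>With the parameter interval as a probability space, a bounded measurable
    function on the product is integrable.\<close>
  define L where "L = restrict_space (lborel :: real measure) {0..1}"
  have spL: "space L = {0..1}" by (simp add: L_def space_restrict_space)
  interpret L: prob_space L
    by standard (simp add: L_def space_restrict_space emeasure_restrict_space)
  interpret P: pair_prob_space L M ..
  have TL[measurable]: "(\<lambda>(t, x). T t x) \<in> L \<Otimes>\<^sub>M M \<rightarrow>\<^sub>M M"
  proof -
    have [measurable]: "(\<lambda>t. t) \<in> L \<rightarrow>\<^sub>M borel" by (simp add: L_def measurable_restrict_space1)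
    have "(\<lambda>p. (fst p, snd p)) \<in> L \<Otimes>\<^sub>M M \<rightarrow>\<^sub>M borel \<Otimes>\<^sub>M M" by measurable
    from measurable_compose[OF this T] show ?thesis by (simp add: case_prod_unfold)
  qed
  have Tt[measurable]: "T t \<in> M \<rightarrow>\<^sub>M M" for t
    using measurable_compose[OF measurable_Pair1' T] by simp
  have Tx: "(\<lambda>t. T t x) \<in> borel \<rightarrow>\<^sub>M M" if "x \<in> space M" for x
    using measurable_compose[OF measurable_Pair2'[OF that] T] by simp
  have sp: "T t x \<in> space M" if "x \<in> space M" for t x
    using measurable_space[OF Tt that] .
  have "(LINT t|L. g (T t x)) = c" if x: "x \<in> space M" for x
  proof -
    have m: "(\<lambda>t. g (T t x)) \<in> borel_measurable borel"
      using measurable_compose[OF Tx[OF x] g] .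
    have "integrable L (\<lambda>t. g (T t x))"
      using m sp[OF x] bound
      by (intro L.integrable_const_bound[where B=C]) (auto simp: L_def measurable_restrict_space1)
    \<comment> \<open>The hypothesis \<open>mean\<close> speaks of a gauge integral; integrability
      in the sense of Lebesgue identifies the two values.\<close>
    then have "set_integrable lborel {0..1} (\<lambda>t. g (T t x))"
      by (simp add: L_def integrable_restrict_space set_integrable_def)
    from set_borel_integral_eq_integral(2)[OF this] mean[OF x] show ?thesis
      by (simp add: L_def integral_restrict_space set_lebesgue_integral_def integral_unique)
  qed
  then have "c = (LINT x|M. LINT t|L. g (T t x))"
    by (simp add: prob_space cong: Bochner_Integration.integral_cong)
  also have "\<dots> = (LINT t|L. LINT x|M. g (T t x))"
  proof (rule P.Fubini_integral)
    have "integrable (L \<Otimes>\<^sub>M M) (\<lambda>p. g (case p of (t, x) \<Rightarrow> T t x))"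
      using sp bound
      by (intro P.integrable_const_bound[where B=C] AE_I2)
        (auto simp: space_pair_measure spL)
    then show "integrable (L \<Otimes>\<^sub>M M) (\<lambda>(t, x). g (T t x))"
      by (simp add: case_prod_unfold)
  qed
  also have "\<dots> = (LINT t|L. integral\<^sup>L M g)"
    by (simp add: integral_distr[OF Tt g, symmetric] inv)
  also have "\<dots> = integral\<^sup>L M g"
    by (simp add: L.prob_space)
  finally show ?thesis ..
qed

lemma measurable_sphere_measureI:
  "\<lbrakk>f \<in> M \<rightarrow>\<^sub>M borel; \<And>x. x \<in> space M \<Longrightarrow> norm (f x) = 1\<rbrakk> \<Longrightarrow> f \<in> M \<rightarrow>\<^sub>M sphere_measure"
  by (simp cong: measurable_cong_sets add: sets_sphere_measure measurable_restrict_space2)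

lemma borel_measurable_sphere_continuous_on:
  "continuous_on (sphere 0 1) f \<Longrightarrow> f \<in> borel_measurable sphere_measure"
  by (simp cong: measurable_cong_sets add: sets_sphere_measure borel_measurable_continuous_on_restrict)

text \<open>The unit circle acts by the orthogonal maps \<open>T a\<close>, which preserve the
  surface measure. Along the orbit of \<open>x\<close> the function \<open>g\<close> agrees with
  \<open>h x\<close>, holomorphic beyond the closed disc, so each orbit mean is the value
  \<open>h x 0\<close>.\<close>

lemma sphere_mean_value:
  fixes T :: "complex \<Rightarrow> 'a \<Rightarrow> 'a::euclidean_space" and g :: "'a \<Rightarrow> complex"
  assumes orth: "\<And>a. norm a = 1 \<Longrightarrow> orthogonal_transformation (T a)"
    and cont: "continuous_on UNIV (\<lambda>(a, x). T a x)"
    and g: "continuous_on (sphere 0 1) g"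
    and h: "\<And>x. norm x = 1 \<Longrightarrow> h x holomorphic_on ball 0 R" "1 < R"
    and gh: "\<And>x a. norm x = 1 \<Longrightarrow> norm a = 1 \<Longrightarrow> g (T a x) = h x a"
    and c: "\<And>x. norm x = 1 \<Longrightarrow> h x 0 = c"
  shows "(LINT x|sphere_measure. g x) = c"
proof -
  interpret prob_space "sphere_measure :: 'a measure" by (rule prob_space_sphere_measure)
  define e where "e t = exp (2 * of_real pi * \<i> * of_real t)" for t :: real
  have e[simp]: "norm (e t) = 1" for t by (simp add: e_def)
  have ec: "continuous_on UNIV e" unfolding e_def by (intro continuous_intros)
  obtain C where C: "\<And>x. x \<in> sphere 0 1 \<Longrightarrow> norm (g x) \<le> C"
    using compact_imp_bounded[OF compact_continuous_image[OF g compact_sphere]]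
    unfolding bounded_iff by blast
  show ?thesis
  proof (rule integral_eq_orbit_mean[where T = "\<lambda>t. T (e t)" and C = C])
    have "continuous_on UNIV (\<lambda>p :: real \<times> 'a. (e (fst p), snd p))"
      by (intro continuous_on_Pair continuous_on_compose2[OF ec] continuous_intros) auto
    from continuous_on_compose2[OF cont this]
    have "continuous_on UNIV (\<lambda>p. T (e (fst p)) (snd p))"
      by simp
    then have "(\<lambda>p. T (e (fst p)) (snd p)) \<in> borel_measurable (borel \<Otimes>\<^sub>M borel)"
      by (simp add: borel_prod borel_measurable_continuous_onI)
    then have m: "(\<lambda>p. T (e (fst p)) (snd p)) \<in> borel_measurable (borel \<Otimes>\<^sub>M borel)" .
    have [measurable]: "(\<lambda>x. x) \<in> borel_measurable (sphere_measure :: 'a measure)"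
      by (intro borel_measurable_sphere_continuous_on continuous_on_id)
    have "(\<lambda>p. (fst p, snd p)) \<in> borel \<Otimes>\<^sub>M (sphere_measure :: 'a measure) \<rightarrow>\<^sub>M borel \<Otimes>\<^sub>M borel"
      by measurable
    from measurable_compose[OF this m]
    have "(\<lambda>p. T (e (fst p)) (snd p)) \<in> borel_measurable (borel \<Otimes>\<^sub>M sphere_measure)"
      by simp
    then show "(\<lambda>(t, x). T (e t) x) \<in> borel \<Otimes>\<^sub>M sphere_measure \<rightarrow>\<^sub>M sphere_measure"
      by (intro measurable_sphere_measureI)
        (auto simp: case_prod_unfold space_pair_measure orthogonal_transformation_norm[OF orth])
    show "((\<lambda>t. g (T (e t) x)) has_integral c) {0..1}" if "x \<in> space sphere_measure" for x
      using has_integral_circle_mean[OF h(1) h(2), of x] that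
      by (simp add: gh c e_def)
  qed (use C in \<open>auto simp: distr_sphere_measure_orthogonal_transformation orth
      borel_measurable_sphere_continuous_on g\<close>)
qed

lemma norm_vector_scalar_mult: "norm (a *s x) = norm a * norm (x :: 'a::real_normed_field^'d)"
  by (simp add: norm_vec_def L2_set_def norm_mult power_mult_distrib sum_distrib_left[symmetric]
      real_sqrt_mult)

lemma linear_vector_scalar_mult: "linear ((*s) a :: complex^'d \<Rightarrow> complex^'d)"
  by (intro linearI) (auto simp: vec_eq_iff algebra_simps)

lemma continuous_on_vector_scalar_mult [continuous_intros]:
  fixes f :: "_ \<Rightarrow> complex" and g :: "_ \<Rightarrow> complex^'d"
  assumes "continuous_on S f" "continuous_on S g"
  shows "continuous_on S (\<lambda>x. f x *s g x)"
  unfolding vector_scalar_mult_def by (intro continuous_intros assms)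

text \<open>Holomorphy on complex lines through 0 suffices: the orbit of a point under unimodular
  scalars is a circle around 0 in such a line.\<close>

lemma slice_mean_value:
  fixes F :: "complex^'d \<Rightarrow> complex"
  assumes F: "continuous_on (ball 0 1) F"
    and hol: "\<And>x. norm x = 1 \<Longrightarrow> (\<lambda>a. F (a *s x)) holomorphic_on ball 0 1"
    and r: "0 \<le> r" "r < 1"
  shows "(LINT x|sphere_measure. F (r *\<^sub>R x)) = F 0"
\<comment> \<open>The slice is holomorphic where \<open>r * |a| < 1\<close>. The radius
  \<open>2 / (1 + r)\<close> exceeds 1, satisfies this bound, and makes sense also for
  \<open>r = 0\<close>.\<close>
proof (rule sphere_mean_value[where T = "(*s)" and R = "2 / (1 + r)" and h = "\<lambda>x a. F ((of_real r * a) *s x)"])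
  show "orthogonal_transformation ((*s) a :: complex^'d \<Rightarrow> complex^'d)" if "norm a = 1" for a
    using that by (simp add: orthogonal_transformation linear_vector_scalar_mult norm_vector_scalar_mult)
  show "continuous_on UNIV (\<lambda>(a, x :: complex^'d). a *s x)"
    by (auto simp: case_prod_unfold intro!: continuous_intros)
  show "continuous_on (sphere 0 1) (\<lambda>x. F (r *\<^sub>R x))"
    by (rule continuous_on_compose2[OF F]) (use r in \<open>auto intro!: continuous_intros\<close>)
  show "(\<lambda>a. F ((of_real r * a) *s x)) holomorphic_on ball 0 (2 / (1 + r))" if "norm x = 1" for x
  proof (rule holomorphic_on_compose_gen[OF _ hol[OF that], of "\<lambda>a. of_real r * a", unfolded o_def])
    show "(\<lambda>a. complex_of_real r * a) ` ball 0 (2 / (1 + r)) \<subseteq> ball 0 1"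
    proof clarsimp
      fix a assume a: "cmod a < 2 / (1 + r)"
      have "r * cmod a \<le> r * (2 / (1 + r))" using a r by (intro mult_left_mono) auto
      also have "\<dots> < 1" using r by (simp add: field_simps)
      finally show "cmod (complex_of_real r * a) < 1" using r by (simp add: norm_mult)
    qed
  qed (auto intro!: holomorphic_intros)
  show "1 < 2 / (1 + r)" using r by simp
  show "F (r *\<^sub>R (a *s x)) = F ((of_real r * a) *s x)" for a x
    by (rule arg_cong[of _ _ F]) (simp add: vec_eq_iff scaleR_conv_of_real[where 'a=complex] mult.assoc)
qed auto

text \<open>As a function of \<alpha> the quotient is holomorphic outside the disc of radius
  \<open>norm w\<close>, with value 1 at infinity. Rotating by \<open>cnj a\<close> moves this to
  the inside: for unimodular \<open>a\<close> and \<open>x\<close>, \<open>cnj a * x\<close> is the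
  inverse of \<open>a * cnj x\<close>, and infinity corresponds to \<open>a = 0\<close>.\<close>

lemma circle_herglotz_mean:
  fixes w :: complex
  assumes w: "norm w < 1"
  shows "(LINT \<alpha>|sphere_measure. (\<alpha> + w) / (\<alpha> - w)) = 1"
proof (rule sphere_mean_value[where T = "\<lambda>a x. cnj a * x" and R = "2 / (1 + norm w)"
      and h = "\<lambda>x a. (1 + w * a * cnj x) / (1 - w * a * cnj x)"])
  show "orthogonal_transformation ((*) (cnj a))" if "norm a = 1" for a
    using that by (simp add: orthogonal_transformation linear_times norm_mult)
  show "continuous_on UNIV (\<lambda>(a, x). cnj a * x)"
    by (auto simp: case_prod_unfold intro!: continuous_intros)
  show "continuous_on (sphere 0 1) (\<lambda>\<alpha>. (\<alpha> + w) / (\<alpha> - w))"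
    using w by (auto intro!: continuous_intros)
  show "(\<lambda>a. (1 + w * a * cnj x) / (1 - w * a * cnj x)) holomorphic_on ball 0 (2 / (1 + norm w))"
    if "norm x = 1" for x
  proof -
    have "w * a * cnj x \<noteq> 1" if a: "cmod a < 2 / (1 + norm w)" for a
    proof -
      have "norm (w * a * cnj x) \<le> norm w * (2 / (1 + norm w))"
        using mult_left_mono[OF less_imp_le[OF a] norm_ge_zero[of w]] \<open>norm x = 1\<close>
        by (simp add: norm_mult)
      also have "\<dots> < 1" using w by (simp add: field_simps add_pos_nonneg)
      finally show ?thesis by force
    qed
    then show ?thesis by (auto intro!: holomorphic_intros)
  qed
  show "1 < 2 / (1 + norm w)" using w by (simp add: field_simps add_pos_nonneg)
  show "(cnj a * x + w) / (cnj a * x - w) = (1 + w * a * cnj x) / (1 - w * a * cnj x)"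
    if "norm x = 1" "norm a = 1" for a x
  proof -
    have 1: "a * cnj a = 1" "x * cnj x = 1"
      using that by (simp_all add: complex_norm_square[symmetric])
    then have "1 + w * a * cnj x = (a * cnj x) * (cnj a * x + w)"
      "1 - w * a * cnj x = (a * cnj x) * (cnj a * x - w)"
      by (algebra, algebra)
    moreover have "a * cnj x \<noteq> 0" using that by auto
    ultimately show ?thesis by simp
  qed
qed auto

section \<open>The invariant Poisson kernel\<close>

lemma hermitian_cnj: "cnj (hermitian z w) = hermitian w z"
  by (simp add: hermitian_def mult.commute)

lemma Re_hermitian: "Re (hermitian z w) = inner z w"
  by (simp add: hermitian_def inner_vec_def inner_complex_def)

lemma hermitian_self: "hermitian z z = of_real ((norm z)\<^sup>2)"
  by (rule complex_eqI)
    (simp_all add: Re_hermitian power2_norm_eq_inner, simp add: hermitian_def)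

lemma hermitian_add_left: "hermitian (x + y) w = hermitian x w + hermitian y w"
  by (simp add: hermitian_def algebra_simps sum.distrib)

lemma hermitian_diff_left: "hermitian (x - y) w = hermitian x w - hermitian y w"
  by (simp add: hermitian_def algebra_simps sum_subtractf)

lemma hermitian_diff_right: "hermitian w (x - y) = hermitian w x - hermitian w y"
  by (simp add: hermitian_def algebra_simps sum_subtractf)

lemma hermitian_scale_left: "hermitian (a *s x) w = a * hermitian x w"
  by (simp add: hermitian_def sum_distrib_left mult_ac)

lemma hermitian_scale_right: "hermitian w (a *s x) = cnj a * hermitian w x"
  by (simp add: hermitian_def sum_distrib_left mult_ac)

lemma hermitian_scaleR_left: "hermitian (r *\<^sub>R x) w = of_real r * hermitian x w"
  by (simp add: hermitian_def sum_distrib_left mult_ac scaleR_conv_of_real[where 'a=complex])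

lemma continuous_on_hermitian [continuous_intros]:
  "continuous_on S f \<Longrightarrow> continuous_on S g \<Longrightarrow> continuous_on S (\<lambda>x. hermitian (f x) (g x))"
  unfolding hermitian_def by (intro continuous_intros)

text \<open>The complex Householder reflection along \<open>x - y\<close>.\<close>

lemma unitary_transitive:
  fixes x y :: "complex^'d"
  assumes "norm x = norm y"
  obtains U where "orthogonal_transformation U" "U x = y"
    "\<And>v w. hermitian (U v) (U w) = hermitian v w"
proof (cases "x = y")
  case True
  then show ?thesis using that[of "\<lambda>x. x"] by simp
next
  case False
  define u where "u = x - y"
  \<comment> \<open>This scalar gives \<open>U x = x - u = y\<close>. It is complex in general, and
    the relation between \<open>c + cnj c\<close> and \<open>c * cnj c\<close> below is what makes
    \<open>U\<close> preserve the Hermitian product.\<close>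
  define c where "c = 1 / hermitian x u"
  have re: "2 * Re (hermitian x u) = (norm u)\<^sup>2"
    using assms
    by (simp add: Re_hermitian u_def power2_norm_eq_inner inner_diff inner_commute norm_eq)
  have nu: "norm u \<noteq> 0" using False by (simp add: u_def)
  with re have h0: "hermitian x u \<noteq> 0" by auto
  have c: "c + cnj c = c * cnj c * of_real ((norm u)\<^sup>2)"
  proof -
    have "hermitian x u + cnj (hermitian x u) = of_real ((norm u)\<^sup>2)"
      by (simp only: complex_add_cnj re)
    with h0 show ?thesis by (simp add: c_def field_simps)
  qed
  define U where "U v = v - (c * hermitian v u) *s u" for v
  have herm: "hermitian (U v) (U w) = hermitian v w" for v w
  proof -
    have "hermitian (U v) (U w) = hermitian v w
        - hermitian v u * hermitian u w * (c + cnj c - c * cnj c * of_real ((norm u)\<^sup>2))"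
      by (simp add: U_def hermitian_diff_left hermitian_diff_right hermitian_scale_left
          hermitian_scale_right hermitian_self hermitian_cnj algebra_simps)
    with c show ?thesis by simp
  qed
  moreover have "U x = y"
    using h0 by (simp add: U_def c_def u_def vec_eq_iff)
  moreover have "orthogonal_transformation U"
    unfolding orthogonal_transformation_def
  proof
    show "linear U"
    proof (rule linearI)
      show "U (v + w) = U v + U w" for v w
        by (simp add: U_def hermitian_add_left vec_eq_iff algebra_simps)
      show "U (k *\<^sub>R v) = k *\<^sub>R U v" for k v
        unfolding U_def hermitian_scaleR_left vec_eq_iff
        by (simp add: scaleR_conv_of_real[where 'a=complex] right_diff_distrib mult.left_commute mult.assoc)
    qed
    show "\<forall>v w. U v \<bullet> U w = v \<bullet> w"
      by (simp add: Re_hermitian[symmetric] herm)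
  qed
  ultimately show ?thesis using that by blast
qed

lemma poisson_kernel_0: "poisson_kernel 0 w = 1"
  by (simp add: poisson_kernel_def hermitian_def)

lemma poisson_kernel_nonneg: "norm z \<le> 1 \<Longrightarrow> 0 \<le> poisson_kernel z w"
  by (simp add: poisson_kernel_def power_le_one)

text \<open>On the sphere \<open>Re (1 - hermitian (r *\<^sub>R x) y)\<close> equals
  \<open>1 - r + r * (dist x y)^2 / 2\<close>, which bounds the denominator from below. With
  positive \<delta> the bound vanishes as \<open>r\<close> tends to 1; with \<delta> equal to 0 it
  is a global bound for fixed \<open>r\<close>.\<close>

lemma poisson_kernel_le:
  fixes x y :: "complex^'d"
  assumes x: "norm x = 1" and y: "norm y = 1" and r: "0 \<le> r" "r < 1"
    and \<delta>: "0 \<le> \<delta>" "\<delta> \<le> dist x y"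
  shows "poisson_kernel (r *\<^sub>R x) y \<le> ((1 - r\<^sup>2) / (1 - r + r * \<delta>\<^sup>2 / 2)\<^sup>2) ^ CARD('d)"
proof -
  have "inner x x = 1" "inner y y = 1"
    using x y by (simp_all add: norm_eq_1)
  then have "(dist x y)\<^sup>2 = 2 - 2 * inner x y"
    by (simp add: dist_norm power2_norm_eq_inner inner_diff inner_commute)
  moreover have "\<delta>\<^sup>2 \<le> (dist x y)\<^sup>2" using \<delta> by (intro power_mono)
  ultimately have "\<delta>\<^sup>2 / 2 \<le> 1 - inner x y" by simp
  from mult_left_mono[OF this r(1)]
  have "1 - r + r * \<delta>\<^sup>2 / 2 \<le> Re (1 - hermitian (r *\<^sub>R x) y)"
    by (simp add: hermitian_scaleR_left Re_hermitian algebra_simps)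
  also have "\<dots> \<le> cmod (1 - hermitian (r *\<^sub>R x) y)" by (rule complex_Re_le_cmod)
  finally have "1 - r + r * \<delta>\<^sup>2 / 2 \<le> cmod (1 - hermitian (r *\<^sub>R x) y)" .
  moreover have "0 < 1 - r + r * \<delta>\<^sup>2 / 2" using r by (simp add: add_pos_nonneg)
  moreover have "r\<^sup>2 \<le> 1" using r by (simp add: power_le_one)
  ultimately show ?thesis
    using x r by (auto simp: poisson_kernel_def intro!: power_mono divide_left_mono mult_pos_pos zero_less_power)
qed

lemma borel_measurable_poisson_kernel:
  "(\<lambda>(w, z). poisson_kernel (r *\<^sub>R z) w) \<in> borel_measurable (borel \<Otimes>\<^sub>M borel)"
proof -
  have [measurable]: "(\<lambda>p :: (complex^'d) \<times> (complex^'d). hermitian (r *\<^sub>R snd p) (fst p)) \<in> borel_measurable (borel \<Otimes>\<^sub>M borel)"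
    unfolding borel_prod by (intro borel_measurable_continuous_onI continuous_intros)
  show ?thesis
    unfolding poisson_kernel_def case_prod_unfold by measurable
qed

text \<open>The measure \<open>M\<close> is left open so that this covers the Clark measures as well
  as the surface measure.\<close>

lemma borel_measurable_poisson_kernel_sphere:
  assumes "sets M = sets (sphere_measure :: (complex^'d) measure)"
  shows "(\<lambda>(w, z). poisson_kernel (r *\<^sub>R z) w)
    \<in> borel_measurable (M \<Otimes>\<^sub>M (sphere_measure :: (complex^'d) measure))"
proof -
  have [measurable]: "(\<lambda>x. x) \<in> borel_measurable (sphere_measure :: (complex^'d) measure)"
    by (intro borel_measurable_sphere_continuous_on continuous_intros)
  have [measurable]: "(\<lambda>x. x) \<in> borel_measurable M"
    using borel_measurable_sphere_continuous_on[OF continuous_on_id]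
    by (simp cong: measurable_cong_sets add: assms)
  have "(\<lambda>p. (fst p, snd p)) \<in> M \<Otimes>\<^sub>M (sphere_measure :: (complex^'d) measure) \<rightarrow>\<^sub>M borel \<Otimes>\<^sub>M borel"
    by measurable
  from measurable_compose[OF this borel_measurable_poisson_kernel[of r]] show ?thesis
    by (simp add: case_prod_unfold)
qed

lemma continuous_on_compact_norm_bound:
  fixes f :: "'a::topological_space \<Rightarrow> 'b::real_normed_vector"
  assumes "continuous_on S f" "compact S"
  obtains C where "0 \<le> C" "\<And>x. x \<in> S \<Longrightarrow> norm (f x) \<le> C"
  using bounded_pos[THEN iffD1, OF compact_imp_bounded[OF compact_continuous_image[OF assms]]]
  by (metis image_eqI less_imp_le)

lemma integrable_sphere_measure_continuous_on:
  fixes f :: "'a::euclidean_space \<Rightarrow> 'b::{banach, second_countable_topology}"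
  assumes "continuous_on (sphere 0 1) f"
  shows "integrable sphere_measure f"
proof -
  interpret prob_space "sphere_measure :: 'a measure" by (rule prob_space_sphere_measure)
  obtain C where "\<And>x. x \<in> sphere 0 1 \<Longrightarrow> norm (f x) \<le> C"
    using continuous_on_compact_norm_bound[OF assms compact_sphere] by blast
  then show ?thesis
    by (intro integrable_const_bound[where B = C]) (auto intro: borel_measurable_sphere_continuous_on assms)
qed

lemma continuous_on_poisson_kernel:
  assumes r: "0 \<le> r" "r < 1" and w: "norm w = 1"
  shows "continuous_on (sphere 0 1) (\<lambda>z. poisson_kernel (r *\<^sub>R z) w)"
proof -
  have "hermitian (r *\<^sub>R z) w \<noteq> 1" if z: "norm z = 1" for z
  proof
    assume "hermitian (r *\<^sub>R z) w = 1"
    then have "r * inner z w = 1"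
      by (metis Re_hermitian inner_scaleR_left one_complex.sel(1))
    moreover have "inner z w \<le> 1" using norm_cauchy_schwarz[of z w] z w by simp
    then have "r * inner z w \<le> r" using r by (simp add: mult_left_le)
    ultimately show False using r by simp
  qed
  then show ?thesis
    unfolding poisson_kernel_def by (intro continuous_intros) auto
qed

text \<open>Substitute \<open>U z\<close> for \<open>z\<close>, with a unitary \<open>U\<close>
  taking \<open>x\<close> to \<open>y\<close>: it preserves the surface measure and the kernel. The
  common value is determined later, with the help of a Clark measure.\<close>

lemma poisson_integral_unitary_invariant:
  fixes x y :: "complex^'d"
  assumes "norm x = 1" "norm y = 1"
  shows "(LINT z|sphere_measure. poisson_kernel (r *\<^sub>R z) x)
    = (LINT z|sphere_measure. poisson_kernel (r *\<^sub>R z) y)"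
proof -
  obtain U where U: "orthogonal_transformation U" "U x = y"
    "\<And>v w. hermitian (U v) (U w) = hermitian v w"
    using unitary_transitive[of x y] assms by metis
  have P: "poisson_kernel (r *\<^sub>R U z) (U w) = poisson_kernel (r *\<^sub>R z) w" for z w
    by (simp add: poisson_kernel_def hermitian_scaleR_left U(3) orthogonal_transformation_norm[OF U(1)])
  have "(\<lambda>z. poisson_kernel (r *\<^sub>R z) y) \<in> borel_measurable sphere_measure"
    using measurable_compose[OF measurable_Pair1'[of y "sphere_measure :: (complex^'d) measure"]
        borel_measurable_poisson_kernel_sphere[OF refl, of r]] assms
    by simp
  from integral_distr[OF measurable_sphere_orthogonal_transformation[OF U(1)] this]
  show ?thesis
    by (simp add: distr_sphere_measure_orthogonal_transformation[OF U(1)] P flip: U(2))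
qed

section \<open>Holomorphic maps and their restrictions to complex lines\<close>

lemma holomorphic_several_continuous_on:
  assumes "holomorphic_several \<phi> S"
  shows "continuous_on S \<phi>"
  using assms has_derivative_continuous continuous_at_imp_continuous_on
  unfolding holomorphic_several_def by metis

lemma holomorphic_several_slice:
  fixes \<phi> :: "complex^'d \<Rightarrow> complex"
  assumes \<phi>: "holomorphic_several \<phi> (ball 0 1)" and x: "norm x = 1"
  shows "(\<lambda>a. \<phi> (a *s x)) holomorphic_on ball 0 1"
proof (rule holomorphic_onI)
  fix a :: complex assume "a \<in> ball 0 1"
  then have "a *s x \<in> ball 0 1" using x by (simp add: norm_vector_scalar_mult)
  then obtain D where D: "(\<phi> has_derivative D) (at (a *s x))" "\<And>c v. D (c *s v) = c * D v"
    using \<phi> unfolding holomorphic_several_def by blast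
  have "bounded_linear (\<lambda>a. a *s x)"
    unfolding linear_conv_bounded_linear[symmetric]
    by (intro linearI) (auto simp: vec_eq_iff algebra_simps)
  then have "((\<lambda>a. a *s x) has_derivative (\<lambda>b. b *s x)) (at a)"
    by (rule bounded_linear_imp_has_derivative)
  from has_derivative_compose[OF this D(1)]
  \<comment> \<open>Complex linearity of \<open>D\<close> turns the real derivative
    \<open>D (b *s x)\<close> into multiplication of \<open>b\<close> by the number
    \<open>D x\<close>.\<close>
  have "((\<lambda>a. \<phi> (a *s x)) has_field_derivative D x) (at a)"
    by (simp add: has_field_derivative_def D(2) mult.commute[of _ "D x"])
  then show "(\<lambda>a. \<phi> (a *s x)) field_differentiable at a within ball 0 1"
    using field_differentiable_at_within field_differentiable_def by blast
qed

text \<open>An approximate identity: the kernel is nonnegative, has mass 1, and tends to 0 uniformly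
  away from \<open>w\<close>. The mass is a hypothesis because its value is only established once a
  Clark measure is at hand.\<close>

lemma tendsto_poisson_integral:
  fixes f :: "complex^'d \<Rightarrow> complex" and w :: "complex^'d"
  assumes f: "continuous_on (sphere 0 1) f" and w: "norm w = 1"
    and P1: "\<And>r. 0 \<le> r \<Longrightarrow> r < 1 \<Longrightarrow> (LINT z|sphere_measure. poisson_kernel (r *\<^sub>R z) w) = 1"
  shows "((\<lambda>r. LINT z|sphere_measure. poisson_kernel (r *\<^sub>R z) w *\<^sub>R f z) \<longlongrightarrow> f w) (at_left 1)"
proof (rule tendstoI)
  fix e :: real assume e: "0 < e"
  interpret prob_space "sphere_measure :: (complex^'d) measure" by (rule prob_space_sphere_measure)
  obtain C where C: "0 \<le> C" "\<And>x. x \<in> sphere 0 1 \<Longrightarrow> norm (f x) \<le> C"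
    using continuous_on_compact_norm_bound[OF f compact_sphere] by blast
  obtain \<delta> where \<delta>: "0 < \<delta>" "\<And>z. norm z = 1 \<Longrightarrow> dist z w < \<delta> \<Longrightarrow> dist (f z) (f w) < e / 2"
    using f w e unfolding continuous_on_iff by (metis half_gt_zero mem_sphere_0)
  \<comment> \<open>The bound of \<open>poisson_kernel_le\<close> at distance at least \<delta>. At
    \<open>r = 1\<close> its numerator vanishes while the denominator is
    \<open>\<delta>^4 / 4\<close>.\<close>
  define K where "K r = ((1 - r\<^sup>2) / (1 - r + r * \<delta>\<^sup>2 / 2)\<^sup>2) ^ CARD('d)" for r :: real
  have "(K \<longlongrightarrow> ((1 - 1\<^sup>2) / (1 - 1 + 1 * \<delta>\<^sup>2 / 2)\<^sup>2) ^ CARD('d)) (at_left 1)"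
    unfolding K_def using \<delta>(1) by (intro tendsto_intros) auto
  then have "((\<lambda>r. 2 * C * K r) \<longlongrightarrow> 2 * C * 0) (at_left 1)"
    by (intro tendsto_intros) (simp add: power_0_left)
  then have "\<forall>\<^sub>F r in at_left 1. 2 * C * K r < e / 2"
    using e by (intro order_tendstoD) auto
  moreover have "\<forall>\<^sub>F r::real in at_left 1. r \<in> {0<..<1}"
    by (rule eventually_at_left_real) simp
  ultimately show "\<forall>\<^sub>F r in at_left 1.
    dist (LINT z|sphere_measure. poisson_kernel (r *\<^sub>R z) w *\<^sub>R f z) (f w) < e"
  proof eventually_elim
    case (elim r)
    then have r: "0 \<le> r" "r < 1" by auto
    note cP = continuous_on_poisson_kernel[OF r w]
    note int = integrable_sphere_measure_continuous_on
    have K: "0 \<le> K r" using r by (simp add: K_def power_le_one)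
    have iP: "integrable sphere_measure (\<lambda>z. poisson_kernel (r *\<^sub>R z) w)" by (rule int[OF cP])
    have "(LINT z|sphere_measure. poisson_kernel (r *\<^sub>R z) w *\<^sub>R f z) - f w
        = (LINT z|sphere_measure. poisson_kernel (r *\<^sub>R z) w *\<^sub>R (f z - f w))"
      using int[OF continuous_on_scaleR[OF cP f]] iP
      by (simp add: scaleR_diff_right P1[OF r])
    \<comment> \<open>One majorant for both regions: the first summand serves points closer to
      \<open>w\<close> than \<delta>, the second all others.\<close>
    also have "norm \<dots> \<le> (LINT z|sphere_measure. poisson_kernel (r *\<^sub>R z) w * (e / 2) + 2 * C * K r)"
    proof (rule Bochner_Integration.integral_norm_bound_integral)
      show "integrable sphere_measure (\<lambda>z. poisson_kernel (r *\<^sub>R z) w *\<^sub>R (f z - f w))"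
        by (intro int continuous_intros cP f)
      show "integrable sphere_measure (\<lambda>z. poisson_kernel (r *\<^sub>R z) w * (e / 2) + 2 * C * K r)"
        using iP by simp
      fix z :: "complex^'d" assume "z \<in> space sphere_measure"
      then have z: "norm z = 1" by simp
      have P0: "0 \<le> poisson_kernel (r *\<^sub>R z) w"
        using r z by (intro poisson_kernel_nonneg) simp
      show "norm (poisson_kernel (r *\<^sub>R z) w *\<^sub>R (f z - f w)) \<le> poisson_kernel (r *\<^sub>R z) w * (e / 2) + 2 * C * K r"
      proof (cases "dist z w < \<delta>")
        case True
        then have "norm (f z - f w) \<le> e / 2" using \<delta>(2)[OF z] by (simp add: dist_norm)
        then have "poisson_kernel (r *\<^sub>R z) w * norm (f z - f w) \<le> poisson_kernel (r *\<^sub>R z) w * (e / 2)"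
          by (intro mult_left_mono P0)
        moreover have "0 \<le> 2 * C * K r" using C(1) K by simp
        ultimately show ?thesis using P0 by simp
      next
        case False
        have "poisson_kernel (r *\<^sub>R z) w \<le> K r"
          unfolding K_def using False \<delta>(1) r z w by (intro poisson_kernel_le) auto
        moreover have "norm (f z - f w) \<le> 2 * C"
          using norm_triangle_ineq4[of "f z" "f w"] C(2)[of z] C(2)[of w] z w by simp
        ultimately have "poisson_kernel (r *\<^sub>R z) w * norm (f z - f w) \<le> K r * (2 * C)"
          using K by (intro mult_mono) auto
        moreover have "0 \<le> poisson_kernel (r *\<^sub>R z) w * (e / 2)" using P0 e by simp
        ultimately show ?thesis using P0 by (simp add: mult_ac)
      qed
    qed
    also have "\<dots> = e / 2 + 2 * C * K r"
      using iP prob_space by (simp add: P1[OF r])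
    also have "\<dots> < e" using elim by simp
    finally show ?case by (simp add: dist_norm)
  qed
qed

section \<open>Clark measures\<close>

text \<open>Kept complex so that it is holomorphic on slices; its real part is the right-hand side
  in \<open>clark_measure\<close>.\<close>

definition herglotz :: "(complex^'d \<Rightarrow> complex) \<Rightarrow> complex \<Rightarrow> complex^'d \<Rightarrow> complex"
  where "herglotz \<phi> \<alpha> z = (\<alpha> + \<phi> z) / (\<alpha> - \<phi> z)"

context
  fixes \<phi> :: "complex^'d \<Rightarrow> complex"
  assumes hol: "holomorphic_several \<phi> (ball 0 1)"
    and disc: "\<phi> ` ball 0 1 \<subseteq> ball 0 1"
begin

lemma norm_self_map_less_1: "norm z < 1 \<Longrightarrow> norm (\<phi> z) < 1"
  using disc by force

lemma continuous_on_self_map_scaled: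
  assumes "0 \<le> r" "r < 1"
  shows "continuous_on (sphere 0 1) (\<lambda>z. \<phi> (r *\<^sub>R z))"
  by (rule continuous_on_compose2[OF holomorphic_several_continuous_on[OF hol]])
    (use assms in \<open>auto intro!: continuous_intros\<close>)

lemma self_map_neq_unimodular: "norm \<alpha> = 1 \<Longrightarrow> norm z < 1 \<Longrightarrow> \<alpha> \<noteq> \<phi> z"
  using norm_self_map_less_1 by force

lemma continuous_on_herglotz_scaled:
  assumes "0 \<le> r" "r < 1" "norm \<alpha> = 1"
  shows "continuous_on (sphere 0 1) (\<lambda>z. herglotz \<phi> \<alpha> (r *\<^sub>R z))"
  unfolding herglotz_def using assms self_map_neq_unimodular
  by (intro continuous_intros continuous_on_self_map_scaled) auto

lemma herglotz_mean_value:
  assumes r: "0 \<le> r" "r < 1" and \<alpha>: "norm \<alpha> = 1"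
  shows "(LINT z|sphere_measure. Re (herglotz \<phi> \<alpha> (r *\<^sub>R z))) = Re (herglotz \<phi> \<alpha> 0)"
proof -
  have "(LINT z|sphere_measure. herglotz \<phi> \<alpha> (r *\<^sub>R z)) = herglotz \<phi> \<alpha> 0"
  proof (rule slice_mean_value[OF _ _ r])
    show "continuous_on (ball 0 1) (herglotz \<phi> \<alpha>)"
      unfolding herglotz_def using \<alpha> self_map_neq_unimodular
      by (intro continuous_intros holomorphic_several_continuous_on[OF hol]) auto
    show "(\<lambda>a. herglotz \<phi> \<alpha> (a *s x)) holomorphic_on ball 0 1" if x: "norm x = 1" for x
      unfolding herglotz_def using \<alpha> x self_map_neq_unimodular
      by (intro holomorphic_intros holomorphic_several_slice[OF hol]) (auto simp: norm_vector_scalar_mult)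
  qed
  then show ?thesis
    using integrable_sphere_measure_continuous_on[OF continuous_on_herglotz_scaled[OF assms]]
    by simp
qed

text \<open>After multiplication by the conjugate of the denominator the cross terms form a number
  minus its conjugate, which is purely imaginary. What remains in the real part is
  \<open>1 - (norm (\<phi> z))^2\<close>.\<close>

lemma Re_herglotz_pos:
  assumes "norm \<alpha> = 1" "norm z < 1"
  shows "0 < Re (herglotz \<phi> \<alpha> z)"
proof -
  have "(\<alpha> + \<phi> z) * cnj (\<alpha> - \<phi> z) = (\<alpha> * cnj \<alpha> - \<phi> z * cnj (\<phi> z)) + (cnj \<alpha> * \<phi> z - cnj (cnj \<alpha> * \<phi> z))"
    by (simp add: algebra_simps)
  then have "Re ((\<alpha> + \<phi> z) * cnj (\<alpha> - \<phi> z)) = (norm \<alpha>)\<^sup>2 - (norm (\<phi> z))\<^sup>2"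
    by (simp only: complex_norm_square[symmetric] minus_complex.sel plus_complex.sel Re_complex_of_real complex_cnj) simp
  moreover have "(norm (\<phi> z))\<^sup>2 < 1"
    using norm_self_map_less_1[OF assms(2)] by (simp add: power_less_one_iff abs_square_less_1)
  ultimately have "0 < Re ((\<alpha> + \<phi> z) * cnj (\<alpha> - \<phi> z))" using assms(1) by simp
  then show ?thesis
    unfolding herglotz_def using self_map_neq_unimodular[OF assms]
    by (simp add: complex_div_cnj[of _ "\<alpha> - \<phi> z"] Re_divide_of_real)
qed

text \<open>The bound is uniform in \<alpha>. Later \<open>M\<close> is the maximum of
  \<open>norm \<phi>\<close> on a smaller sphere, or its value at 0.\<close>

lemma norm_herglotz_le:
  assumes "norm \<alpha> = 1" "norm (\<phi> z) \<le> M" "M < 1"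
  shows "norm (herglotz \<phi> \<alpha> z) \<le> 2 / (1 - M)"
proof -
  have "norm (\<alpha> + \<phi> z) \<le> 2" using norm_triangle_ineq[of \<alpha> "\<phi> z"] assms by simp
  moreover have "1 - M \<le> norm (\<alpha> - \<phi> z)" using norm_triangle_ineq2[of \<alpha> "\<phi> z"] assms by simp
  ultimately show ?thesis
    unfolding herglotz_def norm_divide using assms by (intro frac_le) auto
qed

section \<open>Integration against a single Clark measure\<close>

context
  fixes \<alpha> :: complex and \<mu> :: "(complex^'d) measure"
  assumes \<alpha>: "norm \<alpha> = 1" and clark: "clark_measure \<phi> \<alpha> \<mu>"
begin

lemma sets_clark: "sets \<mu> = sets sphere_measure"
  using clark by (simp add: clark_measure_def sets_sphere_measure)

lemma space_clark: "space \<mu> = sphere 0 1"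
  using sets_eq_imp_space_eq[OF sets_clark] by simp

lemma clark_kernel:
  assumes "norm z < 1"
  shows "integrable \<mu> (poisson_kernel z)" "(LINT w|\<mu>. poisson_kernel z w) = Re (herglotz \<phi> \<alpha> z)"
proof -
  have "has_bochner_integral \<mu> (poisson_kernel z) (Re (herglotz \<phi> \<alpha> z))"
    using clark assms by (simp add: clark_measure_def herglotz_def)
  then show "integrable \<mu> (poisson_kernel z)" "(LINT w|\<mu>. poisson_kernel z w) = Re (herglotz \<phi> \<alpha> z)"
    by (auto simp: has_bochner_integral_iff)
qed

lemma finite_measure_clark: "finite_measure \<mu>"
proof
  have "integrable \<mu> (\<lambda>_. 1 :: real)"
    using clark_kernel(1)[of 0] by (simp add: poisson_kernel_0[abs_def])
  then show "emeasure \<mu> (space \<mu>) \<noteq> \<infinity>"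
    by (simp add: integrable_iff_bounded)
qed

lemma measure_clark: "measure \<mu> (space \<mu>) = Re (herglotz \<phi> \<alpha> 0)"
  using clark_kernel(2)[of 0] by (simp add: poisson_kernel_0)

text \<open>For fixed \<open>r < 1\<close> the kernel is bounded on the product of the spheres, by
  \<open>poisson_kernel_le\<close> with distance bound 0. After the exchange the inner integral is
  the defining property of \<open>\<mu>\<close> at the point \<open>r *\<^sub>R z\<close>.\<close>

lemma Fubini_clark_poisson:
  fixes f :: "complex^'d \<Rightarrow> complex"
  assumes f: "continuous_on (sphere 0 1) f" and r: "0 \<le> r" "r < 1"
  shows "(LINT w|\<mu>. LINT z|sphere_measure. poisson_kernel (r *\<^sub>R z) w *\<^sub>R f z)
    = (LINT z|sphere_measure. Re (herglotz \<phi> \<alpha> (r *\<^sub>R z)) *\<^sub>R f z)"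
proof -
  interpret M: finite_measure \<mu> by (rule finite_measure_clark)
  interpret S: prob_space "sphere_measure :: (complex^'d) measure" by (rule prob_space_sphere_measure)
  interpret P: pair_sigma_finite \<mu> "sphere_measure :: (complex^'d) measure" ..
  interpret P: finite_measure "\<mu> \<Otimes>\<^sub>M (sphere_measure :: (complex^'d) measure)"
    by (rule finite_measure_pair_measure) unfold_locales
  obtain C where C: "0 \<le> C" "\<And>x. x \<in> sphere 0 1 \<Longrightarrow> norm (f x) \<le> C"
    using continuous_on_compact_norm_bound[OF f compact_sphere] by blast
  have "integrable (\<mu> \<Otimes>\<^sub>M sphere_measure) (\<lambda>(w, z). poisson_kernel (r *\<^sub>R z) w *\<^sub>R f z)"
  proof (rule P.integrable_const_bound)
    have [measurable]: "f \<in> borel_measurable sphere_measure"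
      by (rule borel_measurable_sphere_continuous_on[OF f])
    have [measurable]: "(\<lambda>p. poisson_kernel (r *\<^sub>R snd p) (fst p)) \<in> borel_measurable (\<mu> \<Otimes>\<^sub>M sphere_measure)"
      using borel_measurable_poisson_kernel_sphere[OF sets_clark, of r] by (simp add: case_prod_unfold)
    show "(\<lambda>(w, z). poisson_kernel (r *\<^sub>R z) w *\<^sub>R f z) \<in> borel_measurable (\<mu> \<Otimes>\<^sub>M sphere_measure)"
      unfolding case_prod_unfold by measurable
    have "norm (poisson_kernel (r *\<^sub>R z) w *\<^sub>R f z) \<le> ((1 - r\<^sup>2) / (1 - r)\<^sup>2) ^ CARD('d) * C"
      if "norm z = 1" "norm w = 1" for z w
    proof -
      have "0 \<le> poisson_kernel (r *\<^sub>R z) w" using that r by (intro poisson_kernel_nonneg) simp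
      then show ?thesis
        using poisson_kernel_le[of z w r 0] that r C(2)[of z]
        by (auto intro!: mult_mono simp: power_le_one)
    qed
    then show "AE p in \<mu> \<Otimes>\<^sub>M sphere_measure. norm (case p of (w, z) \<Rightarrow> poisson_kernel (r *\<^sub>R z) w *\<^sub>R f z)
        \<le> ((1 - r\<^sup>2) / (1 - r)\<^sup>2) ^ CARD('d) * C"
      by (intro AE_I2) (auto simp: space_pair_measure space_clark)
  qed
  from P.Fubini_integral[OF this]
  have "(LINT w|\<mu>. LINT z|sphere_measure. poisson_kernel (r *\<^sub>R z) w *\<^sub>R f z)
    = (LINT z|sphere_measure. LINT w|\<mu>. poisson_kernel (r *\<^sub>R z) w *\<^sub>R f z)" ..
  also have "\<dots> = (LINT z|sphere_measure. Re (herglotz \<phi> \<alpha> (r *\<^sub>R z)) *\<^sub>R f z)"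
    using r by (intro Bochner_Integration.integral_cong refl) (simp add: clark_kernel)
  finally show ?thesis .
qed

text \<open>
  The Poisson integral of 1 is constant on the sphere by unitary invariance; integrating the constant
  against the Clark measure evaluates it, because the Herglotz transform has the mean value property.
\<close>

lemma poisson_integral_1:
  fixes x :: "complex^'d"
  assumes r: "0 \<le> r" "r < 1" and x: "norm x = 1"
  shows "(LINT z|sphere_measure. poisson_kernel (r *\<^sub>R z) x) = 1"
proof -
  define c where "c = (LINT z|sphere_measure. poisson_kernel (r *\<^sub>R z) x)"
  have "of_real (Re (herglotz \<phi> \<alpha> 0) * c)
      = (LINT w|\<mu>. LINT z|sphere_measure. complex_of_real (poisson_kernel (r *\<^sub>R z) w))"
  proof -
    have "(LINT w|\<mu>. LINT z|sphere_measure. complex_of_real (poisson_kernel (r *\<^sub>R z) w))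
        = (LINT w|\<mu>. complex_of_real c)"
      using poisson_integral_unitary_invariant[OF x]
      by (intro Bochner_Integration.integral_cong refl) (simp add: c_def space_clark)
    then show ?thesis
      by (simp add: measure_clark scaleR_conv_of_real)
  qed
  also have "\<dots> = (LINT z|sphere_measure. complex_of_real (Re (herglotz \<phi> \<alpha> (r *\<^sub>R z))))"
    using Fubini_clark_poisson[OF continuous_on_const[of _ 1] r] by (simp add: scaleR_conv_of_real)
  also have "\<dots> = complex_of_real (Re (herglotz \<phi> \<alpha> 0))"
    by (simp add: herglotz_mean_value[OF r \<alpha>])
  finally have "Re (herglotz \<phi> \<alpha> 0) * c = Re (herglotz \<phi> \<alpha> 0)"
    by (simp only: of_real_eq_iff)
  \<comment> \<open>The mass of \<open>\<mu>\<close> is positive and can be cancelled.\<close>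
  then show ?thesis
    using Re_herglotz_pos[OF \<alpha>, of 0] by (simp add: c_def)
qed

text \<open>By Fubini each term is the \<open>\<mu>\<close>-integral of a Poisson integral of
  \<open>f\<close>. These converge to \<open>f\<close> pointwise and are bounded by
  \<open>C\<close>, since the kernel is nonnegative with mass 1; as \<open>\<mu>\<close> is finite,
  dominated convergence applies.\<close>

lemma tendsto_herglotz_integral:
  fixes f :: "complex^'d \<Rightarrow> complex"
  assumes f: "continuous_on (sphere 0 1) f"
    and r: "\<And>n. 0 \<le> r n" "\<And>n. r n < 1" "r \<longlonglongrightarrow> 1"
  shows "(\<lambda>n. LINT z|sphere_measure. Re (herglotz \<phi> \<alpha> (r n *\<^sub>R z)) *\<^sub>R f z)
    \<longlonglongrightarrow> (LINT w|\<mu>. f w)"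
proof -
  interpret M: finite_measure \<mu> by (rule finite_measure_clark)
  interpret S: prob_space "sphere_measure :: (complex^'d) measure" by (rule prob_space_sphere_measure)
  obtain C where C: "0 \<le> C" "\<And>x. x \<in> sphere 0 1 \<Longrightarrow> norm (f x) \<le> C"
    using continuous_on_compact_norm_bound[OF f compact_sphere] by blast
  have fm[measurable]: "f \<in> borel_measurable sphere_measure"
    by (rule borel_measurable_sphere_continuous_on[OF f])
  have rlim: "filterlim r (at_left 1) sequentially"
    using r by (auto simp: filterlim_at less_imp_neq)
  have "(\<lambda>n. LINT w|\<mu>. LINT z|sphere_measure. poisson_kernel (r n *\<^sub>R z) w *\<^sub>R f z) \<longlonglongrightarrow> (LINT w|\<mu>. f w)"
  proof (rule integral_dominated_convergence[where w = "\<lambda>_. C"])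
    show "f \<in> borel_measurable \<mu>"
      using fm by (simp cong: measurable_cong_sets add: sets_clark)
    show "(\<lambda>w. LINT z|sphere_measure. poisson_kernel (r n *\<^sub>R z) w *\<^sub>R f z) \<in> borel_measurable \<mu>" for n
    proof -
      have [measurable]: "(\<lambda>p. poisson_kernel (r n *\<^sub>R snd p) (fst p)) \<in> borel_measurable (\<mu> \<Otimes>\<^sub>M sphere_measure)"
        using borel_measurable_poisson_kernel_sphere[OF sets_clark, of "r n"] by (simp add: case_prod_unfold)
      show ?thesis
        by (rule S.borel_measurable_lebesgue_integral) (simp add: case_prod_unfold)
    qed
    show "AE w in \<mu>. (\<lambda>n. LINT z|sphere_measure. poisson_kernel (r n *\<^sub>R z) w *\<^sub>R f z) \<longlonglongrightarrow> f w"
    proof (rule AE_I2)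
      fix w assume "w \<in> space \<mu>"
      then have w: "norm w = 1" by (simp add: space_clark)
      show "(\<lambda>n. LINT z|sphere_measure. poisson_kernel (r n *\<^sub>R z) w *\<^sub>R f z) \<longlonglongrightarrow> f w"
        by (rule filterlim_compose[OF tendsto_poisson_integral[OF f w poisson_integral_1[OF _ _ w]] rlim])
    qed
    show "AE w in \<mu>. norm (LINT z|sphere_measure. poisson_kernel (r n *\<^sub>R z) w *\<^sub>R f z) \<le> C" for n
    proof (rule AE_I2)
      fix w assume "w \<in> space \<mu>"
      then have w: "norm w = 1" by (simp add: space_clark)
      note cP = continuous_on_poisson_kernel[OF r(1) r(2) w, of n]
      have "norm (LINT z|sphere_measure. poisson_kernel (r n *\<^sub>R z) w *\<^sub>R f z)
          \<le> (LINT z|sphere_measure. poisson_kernel (r n *\<^sub>R z) w * C)"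
      proof (rule Bochner_Integration.integral_norm_bound_integral)
        fix z :: "complex^'d" assume "z \<in> space sphere_measure"
        then have z: "norm z = 1" by simp
        have "0 \<le> poisson_kernel (r n *\<^sub>R z) w" using z r(1,2)[of n] by (intro poisson_kernel_nonneg) simp
        then show "norm (poisson_kernel (r n *\<^sub>R z) w *\<^sub>R f z) \<le> poisson_kernel (r n *\<^sub>R z) w * C"
          using C(2)[of z] z by (simp add: mult_left_mono)
      qed (intro integrable_sphere_measure_continuous_on continuous_intros cP f)+
      also have "\<dots> = C" by (simp add: poisson_integral_1[OF r(1) r(2) w])
      finally show "norm (LINT z|sphere_measure. poisson_kernel (r n *\<^sub>R z) w *\<^sub>R f z) \<le> C" .
    qed
  qed simp
  then show ?thesis by (simp add: Fubini_clark_poisson[OF f r(1) r(2)])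
qed

end

section \<open>Averaging over the circle parameter\<close>

lemma herglotz_circle_mean:
  assumes "norm z < 1"
  shows "integrable sphere_measure (\<lambda>\<alpha>. Re (herglotz \<phi> \<alpha> z))"
    "(LINT \<alpha>|sphere_measure. Re (herglotz \<phi> \<alpha> z)) = 1"
proof -
  have "integrable sphere_measure (\<lambda>\<alpha>. herglotz \<phi> \<alpha> z)"
    unfolding herglotz_def using assms self_map_neq_unimodular
    by (intro integrable_sphere_measure_continuous_on continuous_intros) auto
  then show "integrable sphere_measure (\<lambda>\<alpha>. Re (herglotz \<phi> \<alpha> z))"
    "(LINT \<alpha>|sphere_measure. Re (herglotz \<phi> \<alpha> z)) = 1"
    using circle_herglotz_mean[OF norm_self_map_less_1[OF assms]] by (simp_all add: herglotz_def)
qed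

text \<open>For fixed \<open>r\<close> the integrand is bounded on the product, so Fubini applies,
  and the mean over \<alpha> of the Herglotz factor is 1. The measurability claim is what the limit
  in \<open>r\<close> passes on to the Clark integrals.\<close>

lemma herglotz_double_integral:
  fixes f :: "complex^'d \<Rightarrow> complex"
  assumes f: "continuous_on (sphere 0 1) f" and r: "0 \<le> r" "r < 1"
  shows "(\<lambda>\<alpha>. LINT z|sphere_measure. Re (herglotz \<phi> \<alpha> (r *\<^sub>R z)) *\<^sub>R f z) \<in> borel_measurable sphere_measure"
    "(LINT \<alpha>|sphere_measure. LINT z|sphere_measure. Re (herglotz \<phi> \<alpha> (r *\<^sub>R z)) *\<^sub>R f z)
      = (LINT z|sphere_measure. f z)"
proof -
  interpret T: prob_space "sphere_measure :: complex measure" by (rule prob_space_sphere_measure)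
  interpret S: prob_space "sphere_measure :: (complex^'d) measure" by (rule prob_space_sphere_measure)
  interpret P: pair_prob_space "sphere_measure :: complex measure" "sphere_measure :: (complex^'d) measure" ..
  have [measurable]: "f \<in> borel_measurable sphere_measure"
    "(\<lambda>z. \<phi> (r *\<^sub>R z)) \<in> borel_measurable sphere_measure"
    "(\<lambda>\<alpha>. \<alpha>) \<in> borel_measurable (sphere_measure :: complex measure)"
    by (intro borel_measurable_sphere_continuous_on f continuous_on_self_map_scaled r continuous_on_id)+
  have m: "(\<lambda>(\<alpha>, z). Re (herglotz \<phi> \<alpha> (r *\<^sub>R z)) *\<^sub>R f z)
      \<in> borel_measurable (sphere_measure \<Otimes>\<^sub>M sphere_measure)"
    unfolding herglotz_def case_prod_unfold by measurable
  then show "(\<lambda>\<alpha>. LINT z|sphere_measure. Re (herglotz \<phi> \<alpha> (r *\<^sub>R z)) *\<^sub>R f z) \<in> borel_measurable sphere_measure"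
    by (rule S.borel_measurable_lebesgue_integral)
  obtain C where C: "0 \<le> C" "\<And>x. x \<in> sphere 0 1 \<Longrightarrow> norm (f x) \<le> C"
    using continuous_on_compact_norm_bound[OF f compact_sphere] by blast
  \<comment> \<open>The maximum of \<open>norm \<phi>\<close> on the sphere of radius
    \<open>r\<close> is attained inside the ball, hence strictly below 1, and keeps the denominators
    away from 0.\<close>
  obtain z0 :: "complex^'d" where z0: "norm z0 = 1"
    "\<And>z. norm z = 1 \<Longrightarrow> norm (\<phi> (r *\<^sub>R z)) \<le> norm (\<phi> (r *\<^sub>R z0))"
    using continuous_attains_sup[OF compact_sphere _ continuous_on_norm[OF continuous_on_self_map_scaled[OF r]]]
    by auto
  define M where "M = norm (\<phi> (r *\<^sub>R z0))"
  have M: "M < 1" unfolding M_def using r z0(1) by (intro norm_self_map_less_1) simp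
  have "integrable (sphere_measure \<Otimes>\<^sub>M sphere_measure) (\<lambda>(\<alpha>, z). Re (herglotz \<phi> \<alpha> (r *\<^sub>R z)) *\<^sub>R f z)"
  proof (rule P.integrable_const_bound[OF _ m])
    have "norm (Re (herglotz \<phi> \<alpha> (r *\<^sub>R z)) *\<^sub>R f z) \<le> 2 / (1 - M) * C"
      if "norm \<alpha> = 1" "norm z = 1" for \<alpha> z
    proof -
      have "\<bar>Re (herglotz \<phi> \<alpha> (r *\<^sub>R z))\<bar> \<le> 2 / (1 - M)"
        using abs_Re_le_cmod norm_herglotz_le[OF that(1) z0(2)[OF that(2), folded M_def] M] by (rule order_trans)
      then have "\<bar>Re (herglotz \<phi> \<alpha> (r *\<^sub>R z))\<bar> * norm (f z) \<le> 2 / (1 - M) * C"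
        using C(2)[of z] that M by (intro mult_mono) auto
      then show ?thesis by simp
    qed
    then show "AE p in sphere_measure \<Otimes>\<^sub>M sphere_measure.
        norm (case p of (\<alpha>, z) \<Rightarrow> Re (herglotz \<phi> \<alpha> (r *\<^sub>R z)) *\<^sub>R f z) \<le> 2 / (1 - M) * C"
      by (intro AE_I2) (auto simp: space_pair_measure)
  qed
  from P.Fubini_integral[OF this]
  have "(LINT \<alpha>|sphere_measure. LINT z|sphere_measure. Re (herglotz \<phi> \<alpha> (r *\<^sub>R z)) *\<^sub>R f z)
      = (LINT z|sphere_measure. LINT \<alpha>|sphere_measure. Re (herglotz \<phi> \<alpha> (r *\<^sub>R z)) *\<^sub>R f z)" ..
  also have "\<dots> = (LINT z|sphere_measure. f z)"
    using r by (intro Bochner_Integration.integral_cong refl) (simp add: herglotz_circle_mean)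
  finally show "(LINT \<alpha>|sphere_measure. LINT z|sphere_measure. Re (herglotz \<phi> \<alpha> (r *\<^sub>R z)) *\<^sub>R f z)
      = (LINT z|sphere_measure. f z)" .
qed

text \<open>Positivity and the mean value property give a bound free of \<open>r\<close>, fit to
  dominate the passage to \<open>r = 1\<close>; the bound used for Fubini depends on
  \<open>r\<close>.\<close>

lemma norm_herglotz_integral_le:
  fixes f :: "complex^'d \<Rightarrow> complex"
  assumes f: "continuous_on (sphere 0 1) f" and r: "0 \<le> r" "r < 1" and \<alpha>: "norm \<alpha> = 1"
    and C: "\<And>x. norm x = 1 \<Longrightarrow> norm (f x) \<le> C"
  shows "norm (LINT z|sphere_measure. Re (herglotz \<phi> \<alpha> (r *\<^sub>R z)) *\<^sub>R f z) \<le> Re (herglotz \<phi> \<alpha> 0) * C"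
proof -
  note cH = continuous_on_herglotz_scaled[OF r \<alpha>]
  have "norm (LINT z|sphere_measure. Re (herglotz \<phi> \<alpha> (r *\<^sub>R z)) *\<^sub>R f z)
      \<le> (LINT z|sphere_measure. Re (herglotz \<phi> \<alpha> (r *\<^sub>R z)) * C)"
  proof (rule Bochner_Integration.integral_norm_bound_integral)
    fix z :: "complex^'d" assume "z \<in> space sphere_measure"
    then have z: "norm z = 1" by simp
    then have "0 < Re (herglotz \<phi> \<alpha> (r *\<^sub>R z))"
      using r by (intro Re_herglotz_pos \<alpha>) simp
    then show "norm (Re (herglotz \<phi> \<alpha> (r *\<^sub>R z)) *\<^sub>R f z) \<le> Re (herglotz \<phi> \<alpha> (r *\<^sub>R z)) * C"
      using C[OF z] by (simp add: mult_left_mono)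
  qed (intro integrable_sphere_measure_continuous_on continuous_intros cH f)+
  also have "\<dots> = Re (herglotz \<phi> \<alpha> 0) * C"
    by (simp add: herglotz_mean_value[OF r \<alpha>])
  finally show ?thesis .
qed

end

theorem theorem3p3:
  fixes \<phi> :: "complex^'d \<Rightarrow> complex"
    and \<sigma> :: "complex \<Rightarrow> (complex^'d) measure"
    and f :: "complex^'d \<Rightarrow> complex"
  assumes "holomorphic_several \<phi> (ball 0 1)"
    and "\<phi> ` ball 0 1 \<subseteq> ball 0 1"
    and "\<And>\<alpha>. \<alpha> \<in> sphere 0 1 \<Longrightarrow> clark_measure \<phi> \<alpha> (\<sigma> \<alpha>)"
    and "continuous_on (sphere 0 1) f"
  shows "integrable sphere_measure (\<lambda>\<alpha>. LINT \<zeta>|\<sigma> \<alpha>. f \<zeta>) \<and>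
    (LINT \<alpha>|sphere_measure. LINT \<zeta>|\<sigma> \<alpha>. f \<zeta>) = (LINT \<zeta>|sphere_measure. f \<zeta>)"
proof -
  note \<phi> = assms(1,2) and f = assms(4)
  interpret prob_space "sphere_measure :: complex measure" by (rule prob_space_sphere_measure)
  \<comment> \<open>Dominated convergence is applied along a sequence of radii; \<open>Suc\<close>
    gives \<open>r 0 = 0\<close>.\<close>
  define r where "r n = 1 - inverse (real (Suc n))" for n
  have r: "0 \<le> r n" "r n < 1" for n by (auto simp: r_def inverse_le_1_iff)
  have rlim: "r \<longlonglongrightarrow> 1"
    unfolding r_def using tendsto_diff[OF tendsto_const LIMSEQ_inverse_real_of_nat] by simp
  define F where "F n \<alpha> = (LINT z|sphere_measure. Re (herglotz \<phi> \<alpha> (r n *\<^sub>R z)) *\<^sub>R f z)" for n \<alpha>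
  obtain C where C: "0 \<le> C" "\<And>x. x \<in> sphere 0 1 \<Longrightarrow> norm (f x) \<le> C"
    using continuous_on_compact_norm_bound[OF f compact_sphere] by blast
  \<comment> \<open>A bound for \<open>Re (herglotz \<phi> \<alpha> 0) * C\<close> uniform in
    \<alpha>; being constant, it is integrable over the circle.\<close>
  define K where "K = 2 / (1 - norm (\<phi> 0)) * C"
  have \<phi>0: "norm (\<phi> 0) < 1" by (rule norm_self_map_less_1[OF \<phi>]) simp
  have Fm: "F n \<in> borel_measurable sphere_measure" for n
    unfolding F_def by (rule herglotz_double_integral(1)[OF \<phi> f r])
  have lim: "(\<lambda>n. F n \<alpha>) \<longlonglongrightarrow> (LINT \<zeta>|\<sigma> \<alpha>. f \<zeta>)" if "norm \<alpha> = 1" for \<alpha>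
    unfolding F_def using that assms(3) by (intro tendsto_herglotz_integral \<phi> f r rlim) auto
  have bound: "norm (F n \<alpha>) \<le> K" if "norm \<alpha> = 1" for n \<alpha>
  proof -
    have "norm (F n \<alpha>) \<le> Re (herglotz \<phi> \<alpha> 0) * C"
      unfolding F_def using that C by (intro norm_herglotz_integral_le \<phi> f r) auto
    also have "\<dots> \<le> K"
      unfolding K_def using complex_Re_le_cmod norm_herglotz_le[OF \<phi> that order_refl \<phi>0] C(1)
      by (intro mult_right_mono) (auto intro: order_trans)
    finally show ?thesis .
  qed
  \<comment> \<open>Measurability in \<alpha> of the Clark integrals is obtained as that of a
    pointwise limit of the functions \<open>F n\<close>.\<close>
  have Im: "(\<lambda>\<alpha>. LINT \<zeta>|\<sigma> \<alpha>. f \<zeta>) \<in> borel_measurable sphere_measure"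
    by (rule borel_measurable_LIMSEQ_metric[where f = F, OF Fm]) (simp add: lim)
  have AE: "AE \<alpha> in sphere_measure. (\<lambda>n. F n \<alpha>) \<longlonglongrightarrow> (LINT \<zeta>|\<sigma> \<alpha>. f \<zeta>)"
    "\<And>n. AE \<alpha> in sphere_measure. norm (F n \<alpha>) \<le> K"
    by (auto intro!: AE_I2 lim bound)
  have "(\<lambda>n. LINT \<alpha>|sphere_measure. F n \<alpha>) \<longlonglongrightarrow> (LINT \<alpha>|sphere_measure. LINT \<zeta>|\<sigma> \<alpha>. f \<zeta>)"
    by (rule integral_dominated_convergence[OF Im Fm _ AE]) simp
  \<comment> \<open>The mean of \<open>F n\<close> is the same for every \<open>n\<close>, so the
    limit just found equals it.\<close>
  moreover have "(LINT \<alpha>|sphere_measure. F n \<alpha>) = (LINT \<zeta>|sphere_measure. f \<zeta>)" for n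
    unfolding F_def by (rule herglotz_double_integral(2)[OF \<phi> f r])
  ultimately have "(LINT \<alpha>|sphere_measure. LINT \<zeta>|\<sigma> \<alpha>. f \<zeta>) = (LINT \<zeta>|sphere_measure. f \<zeta>)"
    by (simp add: LIMSEQ_const_iff)
  moreover have "integrable sphere_measure (\<lambda>\<alpha>. LINT \<zeta>|\<sigma> \<alpha>. f \<zeta>)"
    by (rule integrable_dominated_convergence[OF Im Fm _ AE]) simp
  ultimately show ?thesis by blast
qed

end
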